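(* Let $\rho,\sigma:S(V)\to\mathbb{C}$ be the linear maps given by the ensembles of complete and of connected $n$-point functions, respectively. Then $$\rho=\exp_\star\sigma=\sum_{k=0}^\infty\frac{1}{k!}\,\sigma^{\star k},$$ where the convolution exponential is defined by its power series expansion.
   Context: $V$ is the complex vector space of finite linear combinations of field operators $\phi(x)$, $x$ ranging over a set of labels (purely bosonic case). $S(V)=\bigoplus_{k\ge0}V^k$ is the (commutative) symmetric algebra over $V$ with unit $\mathbf 1$. The coproduct $\Delta:S(V)\to S(V)\otimes S(V)$ is the algebra homomorphism with $\Delta(\mathbf 1)=\mathbf 1\otimes\mathbf 1$, $\Delta(\phi(x))=\phi(x)\otimes\mathbf 1+\mathbf 1\otimes\phi(x)$; the counit $\epsilon:S(V)\to\mathbb C$ is given by $\epsilon(\mathbf 1)=1$ and $\epsilon(\phi(x_1)\cdots\phi(x_n))=0$ for $n>0$. The convolution product of linear maps $\alpha,\beta:S(V)\to\mathbb C$ is $\alpha\star\beta:=(\alpha\otimes\beta)\circ\Delta$; it is associative with unit $\epsilon$. $\alpha^{\star k}$ is the $k$-fold convolution product of $\alpha$ with itself, $\alpha^{\star 0}=\epsilon$. $\sigma(\phi(x_1)\cdots\phi(x_n))$ is the connected $n$-point function $G_c^{(n)}(x_1,\dots,x_n)$, with $\sigma(\mathbf 1)=0$ (and $\sigma(\phi(x))=0$). $\rho(\phi(x_1)\cdots\phi(x_n))$ is the complete $n$-point function $G^{(n)}(x_1,\dots,x_n)$, with $\rho(\mathbf 1)=1$. They are related, for $n\ge1$, by $$G^{(n)}(x_1,\dots,x_n)=\sum_{k=1}^n\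 \sum_{I_1\cup\dots\cup I_k=\{x_1,\dots,x_n\}}\ \prod_{j=1}^kG_c(I_j),$$ the inner sum running over unordered partitions of the (distinguishable) labels into $k$ non-empty subsets. *)

theory Defs
  imports Complex_Main "HOL-Library.Poly_Mapping" "HOL-Library.Product_Plus"
    "HOL-Library.Multiset" "HOL-Library.Disjoint_Sets"
begin

section \<open>Free complex vector spaces\<close>

text \<open>
  The type \<open>'m \<Rightarrow>\<^sub>0 complex\<close> is the complex vector space with basis \<open>'m\<close>; if \<open>'m\<close> is a
  commutative monoid, its library multiplication makes it the monoid algebra.
\<close>

definition scale :: "complex \<Rightarrow> ('m \<Rightarrow>\<^sub>0 complex) \<Rightarrow> ('m \<Rightarrow>\<^sub>0 complex)" where
  "scale c p = Poly_Mapping.map ((*) c) p"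

lemma lookup_scale [simp]: "Poly_Mapping.lookup (scale c p) k = c * Poly_Mapping.lookup p k"
  by (simp add: scale_def Poly_Mapping.map.rep_eq when_def)

lemma scale_single [simp]: "scale c (Poly_Mapping.single k d) = Poly_Mapping.single k (c * d)"
  by (rule poly_mapping_eqI) (simp add: lookup_single when_def)

lemma vector_space_scale: "vector_space scale"
  by unfold_locales (auto intro!: poly_mapping_eqI simp: lookup_add algebra_simps)

lemma vector_space_times_complex: "vector_space ((*) :: complex \<Rightarrow> complex \<Rightarrow> complex)"
  by unfold_locales (auto simp: algebra_simps)

definition lin_ext ::
  "(complex \<Rightarrow> 'b \<Rightarrow> 'b) \<Rightarrow> ('m \<Rightarrow> 'b) \<Rightarrow> ('m \<Rightarrow>\<^sub>0 complex) \<Rightarrow> 'b::ab_group_add" where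
  "lin_ext sc f p = (\<Sum>k\<in>Poly_Mapping.keys p. sc (Poly_Mapping.lookup p k) (f k))"

lemma lin_ext_superset:
  assumes "vector_space sc" "finite A" "Poly_Mapping.keys p \<subseteq> A"
  shows "lin_ext sc f p = (\<Sum>k\<in>A. sc (Poly_Mapping.lookup p k) (f k))"
proof -
  interpret vector_space sc by fact
  show ?thesis unfolding lin_ext_def
    by (rule sum.mono_neutral_left) (use assms in \<open>auto simp: in_keys_iff\<close>)
qed

lemma linear_lin_ext:
  assumes "vector_space sc"
  shows "Vector_Spaces.linear scale sc (lin_ext sc f)"
proof -
  interpret V: vector_space sc by fact
  interpret S: vector_space "scale :: complex \<Rightarrow> ('b \<Rightarrow>\<^sub>0 complex) \<Rightarrow> _" by (rule vector_space_scale)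
  show ?thesis
  proof
    fix p q :: "'b \<Rightarrow>\<^sub>0 complex"
    let ?A = "Poly_Mapping.keys p \<union> Poly_Mapping.keys q"
    have "lin_ext sc f (p + q) = (\<Sum>k\<in>?A. sc (Poly_Mapping.lookup (p + q) k) (f k))"
      by (rule lin_ext_superset[OF assms]) (use Poly_Mapping.keys_add[of p q] in auto)
    moreover have "lin_ext sc f p = (\<Sum>k\<in>?A. sc (Poly_Mapping.lookup p k) (f k))"
      by (rule lin_ext_superset[OF assms]) auto
    moreover have "lin_ext sc f q = (\<Sum>k\<in>?A. sc (Poly_Mapping.lookup q k) (f k))"
      by (rule lin_ext_superset[OF assms]) auto
    ultimately show "lin_ext sc f (p + q) = lin_ext sc f p + lin_ext sc f q"
      by (simp add: lookup_add V.scale_left_distrib sum.distrib)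
  next
    fix c and p :: "'b \<Rightarrow>\<^sub>0 complex"
    have "lin_ext sc f (scale c p) =
        (\<Sum>k\<in>Poly_Mapping.keys p. sc (Poly_Mapping.lookup (scale c p) k) (f k))"
      by (rule lin_ext_superset[OF assms]) (auto simp: in_keys_iff)
    then show "lin_ext sc f (scale c p) = sc c (lin_ext sc f p)"
      by (simp add: lin_ext_def V.scale_sum_right)
  qed
qed

lemma lin_ext_basis [simp]:
  "vector_space sc \<Longrightarrow> lin_ext sc f (Poly_Mapping.single k 1) = f k"
  by (simp add: lin_ext_def vector_space.vector_space_assms(4))

lemma basis_expansion:
  "p = (\<Sum>k\<in>Poly_Mapping.keys p. scale (Poly_Mapping.lookup p k) (Poly_Mapping.single k 1))"
  by (rule poly_mapping_eqI)
    (auto simp: lookup_sum lookup_single when_def sum.delta in_keys_iff)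

lemma linear_eq_lin_ext:
  assumes "Vector_Spaces.linear scale sc h"
  shows "h = lin_ext sc (\<lambda>k. h (Poly_Mapping.single k 1))"
proof
  fix p
  interpret h: Vector_Spaces.linear scale sc h by fact
  have "h p = h (\<Sum>k\<in>Poly_Mapping.keys p. scale (Poly_Mapping.lookup p k) (Poly_Mapping.single k 1))"
    using basis_expansion[of p] by simp
  then show "h p = lin_ext sc (\<lambda>k. h (Poly_Mapping.single k 1)) p"
    by (simp only: h.sum h.scale lin_ext_def)
qed

lemma linear_eqI:
  assumes "Vector_Spaces.linear scale sc g" "Vector_Spaces.linear scale sc h"
    and "\<And>k. g (Poly_Mapping.single k 1) = h (Poly_Mapping.single k 1)"
  shows "g = h"
  using linear_eq_lin_ext[OF assms(1)] linear_eq_lin_ext[OF assms(2)] assms(3) by simp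

lemma scale_mult_left: "scale c (p * q) = scale c p * q"
  and scale_mult_right: "scale c (p * q) = p * scale c q"
  for p q :: "'m::comm_monoid_add \<Rightarrow>\<^sub>0 complex"
  by (simp_all add: scale_def mult_map_scale_conv_mult algebra_simps)

lemma linear_mult_scale:
  fixes p :: "'m::comm_monoid_add \<Rightarrow>\<^sub>0 complex"
  shows "Vector_Spaces.linear scale scale (\<lambda>q. p * q)"
proof -
  interpret S: vector_space "scale :: complex \<Rightarrow> ('m \<Rightarrow>\<^sub>0 complex) \<Rightarrow> _" by (rule vector_space_scale)
  show ?thesis by unfold_locales (simp_all add: distrib_left scale_mult_right)
qed


section \<open>Commutative algebras and the symmetric algebra\<close>

locale complex_comm_algebra = vector_space sc
  for sc :: "complex \<Rightarrow> 'b \<Rightarrow> 'b::comm_ring_1" +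
  assumes scale_mult: "sc c (x * y) = sc c x * y"

definition algebra_hom ::
  "(complex \<Rightarrow> 'b \<Rightarrow> 'b::comm_ring_1) \<Rightarrow> (complex \<Rightarrow> 'c \<Rightarrow> 'c::comm_ring_1) \<Rightarrow> ('b \<Rightarrow> 'c) \<Rightarrow> bool" where
  "algebra_hom sc1 sc2 h \<longleftrightarrow>
     Vector_Spaces.linear sc1 sc2 h \<and> h 1 = 1 \<and> (\<forall>x y. h (x * y) = h x * h y)"

lemma complex_comm_algebra_scale:
  "complex_comm_algebra (scale :: complex \<Rightarrow> ('m::comm_monoid_add \<Rightarrow>\<^sub>0 complex) \<Rightarrow> _)"
  by (simp add: complex_comm_algebra_def complex_comm_algebra_axioms_def vector_space_scale
      scale_mult_left)

text \<open>
  \<open>V\<close> is free on the operators \<open>\<phi>(x)\<close>, so \<open>S(V)\<close> has as basis the monomials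
  \<open>\<phi>(x\<^sub>1)\<cdots>\<phi>(x\<^sub>n)\<close>, indexed by the multisets of labels; multiplying monomials adds multisets.
\<close>

type_synonym 'a symalg = "'a multiset \<Rightarrow>\<^sub>0 complex"

definition field_op :: "'a \<Rightarrow> 'a symalg" where
  "field_op x = Poly_Mapping.single {#x#} 1"

lemma prod_list_field_op:
  "prod_list (map field_op xs) = Poly_Mapping.single (mset xs) 1"
proof (induction xs)
  case Nil
  show ?case using single_one by simp
next
  case (Cons x xs)
  then show ?case by (simp add: field_op_def mult_single)
qed

lemma symalg_universal:
  fixes sc :: "complex \<Rightarrow> 'b \<Rightarrow> 'b::comm_ring_1" and f :: "'a \<Rightarrow> 'b"
  assumes "complex_comm_algebra sc"
  shows "algebra_hom scale sc (lin_ext sc (\<lambda>M. \<Prod>x\<in>#M. f x))" (is "algebra_hom _ _ ?h")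
    and "lin_ext sc (\<lambda>M. \<Prod>x\<in>#M. f x) (field_op x) = f x"
    and "algebra_hom scale sc h \<Longrightarrow> (\<And>x. h (field_op x) = f x) \<Longrightarrow>
           h = lin_ext sc (\<lambda>M. \<Prod>x\<in>#M. f x)"
proof -
  interpret A: complex_comm_algebra sc by fact
  have vs: "vector_space sc" by (rule A.vector_space_axioms)
  note lin = linear_lin_ext[OF vs, of "\<lambda>M. \<Prod>x\<in>#M. f x"]
  interpret S: vector_space "scale :: complex \<Rightarrow> 'a symalg \<Rightarrow> _" by (rule vector_space_scale)
  have mulc: "sc c (x * y) = x * sc c y" for c x y
    using A.scale_mult[of c y x] by (simp add: mult.commute)
  interpret h: Vector_Spaces.linear scale sc ?h by (rule lin)
  have linl: "Vector_Spaces.linear scale sc (\<lambda>q. ?h (p * q))" for p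
    by unfold_locales (simp_all add: algebra_simps h.add h.scale scale_mult_right[symmetric])
  have linr: "Vector_Spaces.linear scale sc (\<lambda>q. y * ?h q)" for y
    by unfold_locales (simp_all add: algebra_simps h.add h.scale mulc)
  have basis: "(\<lambda>q. ?h (Poly_Mapping.single M 1 * q)) = (\<lambda>q. ?h (Poly_Mapping.single M 1) * ?h q)"
    for M
    by (rule linear_eqI[OF linl linr]) (simp add: mult_single vs)
  have "(\<lambda>p. ?h (q * p)) = (\<lambda>p. ?h q * ?h p)" for q
    by (rule linear_eqI[OF linl linr]) (use fun_cong[OF basis] in \<open>simp add: mult.commute\<close>)
  then have mul: "?h (p * q) = ?h p * ?h q" for p q by meson
  have one: "?h 1 = 1"
    using lin_ext_basis[OF vs, of "\<lambda>M. \<Prod>x\<in>#M. f x" "0"] by simp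
  show "algebra_hom scale sc ?h"
    using lin mul one by (simp add: algebra_hom_def)
  show "?h (field_op x) = f x" by (simp add: field_op_def vs)
  assume h: "algebra_hom scale sc h" and hf: "\<And>x. h (field_op x) = f x"
  have hl: "h (prod_list (map field_op xs)) = prod_list (map f xs)" for xs
    by (induction xs) (use h hf in \<open>auto simp: algebra_hom_def\<close>)
  show "h = ?h"
  proof (rule linear_eqI[OF _ lin])
    show "Vector_Spaces.linear scale sc h" using h by (simp add: algebra_hom_def)
    fix M :: "'a multiset"
    obtain xs where M: "M = mset xs" by (metis ex_mset)
    have "h (Poly_Mapping.single M 1) = prod_list (map f xs)"
      using hl[of xs] by (simp add: prod_list_field_op M)
    also have "\<dots> = (\<Prod>x\<in>#M. f x)"
      by (simp add: M prod_mset_prod_list flip: mset_map)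
    finally show "h (Poly_Mapping.single M 1) = ?h (Poly_Mapping.single M 1)"
      by (simp add: vs)
  qed
qed


section \<open>The tensor square\<close>

text \<open>
  The tensor square has as basis the pairs of monomials.  Pairs of multisets are added
  componentwise, so the library multiplication satisfies
  \<open>(p \<otimes> q)(r \<otimes> s) = pr \<otimes> qs\<close>.
\<close>

type_synonym 'a symalg2 = "('a multiset \<times> 'a multiset) \<Rightarrow>\<^sub>0 complex"

definition tensor :: "'a symalg \<Rightarrow> 'a symalg \<Rightarrow> 'a symalg2" where
  "tensor p q = lin_ext scale (\<lambda>M. lin_ext scale (\<lambda>N. Poly_Mapping.single (M, N) 1) q) p"

lemma tensor_basis [simp]:
  "tensor (Poly_Mapping.single M 1) (Poly_Mapping.single N 1) = Poly_Mapping.single (M, N) 1"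
  by (simp add: tensor_def vector_space_scale)

lemma linear_tensor_left: "Vector_Spaces.linear scale scale (\<lambda>p. tensor p q)"
  unfolding tensor_def by (rule linear_lin_ext[OF vector_space_scale])

lemma linear_tensor_right: "Vector_Spaces.linear scale scale (tensor p)"
  for p :: "'a symalg"
proof -
  interpret P: vector_space_pair "scale :: complex \<Rightarrow> 'a symalg \<Rightarrow> _"
    "scale :: complex \<Rightarrow> 'a symalg2 \<Rightarrow> _"
    by (simp add: vector_space_pair_def vector_space_scale)
  have "Vector_Spaces.linear scale scale
      (\<lambda>q :: 'a symalg. \<Sum>M\<in>Poly_Mapping.keys p.
        scale (Poly_Mapping.lookup p M) (lin_ext scale (\<lambda>N. Poly_Mapping.single (M, N) 1) q))"
    by (intro P.linear_compose_sum ballI P.linear_compose_scale_right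
        linear_lin_ext[OF vector_space_scale])
  then show ?thesis by (simp add: tensor_def[abs_def] lin_ext_def[of _ _ p])
qed

lemma tensor_universal:
  fixes B :: "'a symalg \<Rightarrow> 'a symalg \<Rightarrow> 'b::ab_group_add"
  assumes "\<And>q. Vector_Spaces.linear scale sc (\<lambda>p. B p q)"
    and "\<And>p. Vector_Spaces.linear scale sc (B p)"
  shows "\<exists>!h. Vector_Spaces.linear scale sc h \<and> (\<forall>p q. h (tensor p q) = B p q)"
proof (rule ex1I)
  have vs: "vector_space sc" using assms(1)[of 0] by (simp add: Vector_Spaces.linear_def)
  let ?h = "lin_ext sc (\<lambda>(M, N). B (Poly_Mapping.single M 1) (Poly_Mapping.single N 1))"
  have lin: "Vector_Spaces.linear scale sc ?h" by (rule linear_lin_ext[OF vs])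
  have r: "Vector_Spaces.linear scale sc (\<lambda>q. ?h (tensor p q))" for p
    using Vector_Spaces.linear_compose[OF linear_tensor_right lin] by (simp add: o_def)
  have l: "Vector_Spaces.linear scale sc (\<lambda>p. ?h (tensor p q))" for q
    using Vector_Spaces.linear_compose[OF linear_tensor_left lin] by (simp add: o_def)
  have basis: "(\<lambda>q. ?h (tensor (Poly_Mapping.single M 1) q)) = B (Poly_Mapping.single M 1)" for M
    by (rule linear_eqI[OF r assms(2)]) (simp add: vs)
  have "(\<lambda>p. ?h (tensor p q)) = (\<lambda>p. B p q)" for q
    by (intro linear_eqI[OF l assms(1)]) (rule fun_cong[OF basis])
  then show "Vector_Spaces.linear scale sc ?h \<and> (\<forall>p q. ?h (tensor p q) = B p q)"
    using lin by meson
  fix h assume h: "Vector_Spaces.linear scale sc h \<and> (\<forall>p q. h (tensor p q) = B p q)"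
  show "h = ?h"
  proof (rule linear_eqI[OF _ lin])
    show "Vector_Spaces.linear scale sc h" using h by simp
    fix k :: "'a multiset \<times> 'a multiset"
    obtain M N where k: "k = (M, N)" by fastforce
    show "h (Poly_Mapping.single k 1) = ?h (Poly_Mapping.single k 1)"
      using h tensor_basis[of M N] by (simp add: k vs flip: tensor_basis)
        (simp add: vs)
  qed
qed

lemma tensor_one: "tensor 1 1 = (1 :: 'a symalg2)"
proof -
  have "tensor (Poly_Mapping.single 0 1) (Poly_Mapping.single 0 1) =
      (Poly_Mapping.single 0 1 :: 'a symalg2)"
    unfolding tensor_basis by (simp add: zero_prod_def)
  then show ?thesis by simp
qed

lemma tensor_mult: "tensor p q * tensor r s = tensor (p * r) (q * s)"
  for p q r s :: "'a symalg"
proof -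
  note lc = Vector_Spaces.linear_compose[unfolded o_def]
  have 1: "(\<lambda>s. tensor (Poly_Mapping.single K 1) (Poly_Mapping.single L 1) *
        tensor (Poly_Mapping.single M 1) s) =
      (\<lambda>s. tensor (Poly_Mapping.single K 1 * Poly_Mapping.single M 1) (Poly_Mapping.single L 1 * s))"
    for K L M :: "'a multiset"
    by (rule linear_eqI[OF lc[OF linear_tensor_right linear_mult_scale]
          lc[OF linear_mult_scale linear_tensor_right]])
      (simp add: mult_single)
  have 2: "(\<lambda>r. tensor (Poly_Mapping.single K 1) (Poly_Mapping.single L 1) * tensor r s) =
      (\<lambda>r. tensor (Poly_Mapping.single K 1 * r) (Poly_Mapping.single L 1 * s))"
    for K L :: "'a multiset" and s
    by (rule linear_eqI[OF lc[OF linear_tensor_left linear_mult_scale]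
          lc[OF linear_mult_scale linear_tensor_left]])
      (rule fun_cong[OF 1])
  have 3: "(\<lambda>q. tensor r s * tensor (Poly_Mapping.single K 1) q) =
      (\<lambda>q. tensor (r * Poly_Mapping.single K 1) (s * q))"
    for K :: "'a multiset" and r s :: "'a symalg"
    by (rule linear_eqI[OF lc[OF linear_tensor_right linear_mult_scale]
          lc[OF linear_mult_scale linear_tensor_right]])
      (use fun_cong[OF 2] in \<open>metis mult.commute\<close>)
  have "(\<lambda>p. tensor r s * tensor p q) = (\<lambda>p. tensor (r * p) (s * q))"
    for q r s :: "'a symalg"
    by (rule linear_eqI[OF lc[OF linear_tensor_left linear_mult_scale]
          lc[OF linear_mult_scale linear_tensor_left]])
      (rule fun_cong[OF 3])
  from fun_cong[OF this, of p q r s] show ?thesis by meson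
qed

definition tensor_map :: "('a symalg \<Rightarrow> complex) \<Rightarrow> ('a symalg \<Rightarrow> complex) \<Rightarrow> 'a symalg2 \<Rightarrow> complex" where
  "tensor_map \<alpha> \<beta> =
     lin_ext (*) (\<lambda>(M, N). \<alpha> (Poly_Mapping.single M 1) * \<beta> (Poly_Mapping.single N 1))"

lemma tensor_map_unique:
  assumes \<alpha>: "Vector_Spaces.linear scale (*) \<alpha>" and \<beta>: "Vector_Spaces.linear scale (*) \<beta>"
  shows "Vector_Spaces.linear scale (*) (tensor_map \<alpha> \<beta>)"
    and "tensor_map \<alpha> \<beta> (tensor p q) = \<alpha> p * \<beta> q"
    and "Vector_Spaces.linear scale (*) h \<Longrightarrow> (\<And>p q. h (tensor p q) = \<alpha> p * \<beta> q) \<Longrightarrow>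
           h = tensor_map \<alpha> \<beta>"
proof -
  interpret P: vector_space_pair "scale :: complex \<Rightarrow> 'a symalg \<Rightarrow> _" "(*) :: complex \<Rightarrow> _"
    by (simp add: vector_space_pair_def vector_space_scale vector_space_times_complex)
  have r: "Vector_Spaces.linear scale (*) (\<lambda>q. \<alpha> p * \<beta> q)" for p
    by (rule P.linear_compose_scale_right[OF \<beta>])
  have l: "Vector_Spaces.linear scale (*) (\<lambda>p. \<alpha> p * \<beta> q)" for q
    using P.linear_compose_scale_right[OF \<alpha>, of "\<beta> q"] by (simp add: mult.commute)
  have uniq: "h = tensor_map \<alpha> \<beta>"
    if "Vector_Spaces.linear scale (*) h" "\<And>p q. h (tensor p q) = \<alpha> p * \<beta> q" for h
  proof -
    have "h (Poly_Mapping.single (M, N) 1) = \<alpha> (Poly_Mapping.single M 1) * \<beta> (Poly_Mapping.single N 1)"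
      for M N
      unfolding tensor_basis[symmetric] by (rule that(2))
    then have "(\<lambda>k. h (Poly_Mapping.single k 1)) =
        (\<lambda>(M, N). \<alpha> (Poly_Mapping.single M 1) * \<beta> (Poly_Mapping.single N 1))"
      by (simp add: fun_eq_iff)
    then show ?thesis using linear_eq_lin_ext[OF that(1)] by (simp add: tensor_map_def)
  qed
  show "Vector_Spaces.linear scale (*) h \<Longrightarrow> (\<And>p q. h (tensor p q) = \<alpha> p * \<beta> q) \<Longrightarrow>
           h = tensor_map \<alpha> \<beta>"
    by (rule uniq)
  obtain h where h: "Vector_Spaces.linear scale (*) h" "\<And>p q. h (tensor p q) = \<alpha> p * \<beta> q"
    using tensor_universal[of "(*)" "\<lambda>p q. \<alpha> p * \<beta> q", OF l r] by metis
  then show "Vector_Spaces.linear scale (*) (tensor_map \<alpha> \<beta>)"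
    and "tensor_map \<alpha> \<beta> (tensor p q) = \<alpha> p * \<beta> q"
    using uniq[OF h] by auto
qed


section \<open>Coproduct, counit and convolution\<close>

definition coproduct :: "'a symalg \<Rightarrow> 'a symalg2" where
  "coproduct = lin_ext scale (\<lambda>M. \<Prod>x\<in>#M. tensor (field_op x) 1 + tensor 1 (field_op x))"

lemma coproduct_unique:
  fixes \<Delta> :: "'a symalg \<Rightarrow> 'a symalg2" and x :: 'a
  shows "algebra_hom scale scale (coproduct :: 'a symalg \<Rightarrow> _)"
    and "coproduct (field_op x) = tensor (field_op x) 1 + tensor 1 (field_op x)"
    and "coproduct (1 :: 'a symalg) = tensor 1 1"
    and "algebra_hom scale scale \<Delta> \<Longrightarrow>
           (\<And>x. \<Delta> (field_op x) = tensor (field_op x) 1 + tensor 1 (field_op x)) \<Longrightarrow> \<Delta> = coproduct"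
proof -
  note u = symalg_universal[OF complex_comm_algebra_scale,
      where f = "\<lambda>x::'a. tensor (field_op x) 1 + tensor 1 (field_op x)", folded coproduct_def]
  show "algebra_hom scale scale (coproduct :: 'a symalg \<Rightarrow> _)" by (rule u(1))
  then show "coproduct (1 :: 'a symalg) = tensor 1 1" by (simp add: algebra_hom_def tensor_one)
  show "coproduct (field_op x) = tensor (field_op x) 1 + tensor 1 (field_op x)" by (rule u(2))
  show "algebra_hom scale scale \<Delta> \<Longrightarrow>
      (\<And>x. \<Delta> (field_op x) = tensor (field_op x) 1 + tensor 1 (field_op x)) \<Longrightarrow> \<Delta> = coproduct"
    by (rule u(3))
qed

definition counit :: "'a symalg \<Rightarrow> complex" where
  "counit p = Poly_Mapping.lookup p {#}"

lemma linear_counit: "Vector_Spaces.linear scale (*) counit"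
proof -
  interpret S: vector_space "scale :: complex \<Rightarrow> 'a symalg \<Rightarrow> _" by (rule vector_space_scale)
  interpret C: vector_space "(*) :: complex \<Rightarrow> _" by (rule vector_space_times_complex)
  show ?thesis by unfold_locales (simp_all add: counit_def lookup_add)
qed

lemma counit_one: "counit 1 = 1"
  using lookup_one_zero by (simp add: counit_def lookup_one)

lemma counit_field_ops: "xs \<noteq> [] \<Longrightarrow> counit (prod_list (map field_op xs)) = 0"
  by (simp add: prod_list_field_op counit_def lookup_single)

definition convolution ::
  "('a symalg \<Rightarrow> complex) \<Rightarrow> ('a symalg \<Rightarrow> complex) \<Rightarrow> 'a symalg \<Rightarrow> complex"
  (infixl \<open>\<star>\<close> 70) where
  "\<alpha> \<star> \<beta> = tensor_map \<alpha> \<beta> \<circ> coproduct"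

primrec conv_power :: "('a symalg \<Rightarrow> complex) \<Rightarrow> nat \<Rightarrow> 'a symalg \<Rightarrow> complex" where
  "conv_power \<alpha> 0 = counit"
| "conv_power \<alpha> (Suc k) = \<alpha> \<star> conv_power \<alpha> k"

text \<open>The exponential series is evaluated pointwise; \<open>conv_exp\<close> is meaningful where it converges.\<close>

definition conv_exp :: "('a symalg \<Rightarrow> complex) \<Rightarrow> 'a symalg \<Rightarrow> complex" where
  "conv_exp \<alpha> s = suminf (\<lambda>k. (1 / fact k) * conv_power \<alpha> k s)"


section \<open>Ensembles of n-point functions\<close>

text \<open>
  \<open>F [x\<^sub>1, \<dots>, x\<^sub>n]\<close> is the value of the \<open>n\<close>-point function.  Symmetry of \<open>F\<close> in its arguments
  follows from \<open>given_by_ensemble\<close>, since \<open>S(V)\<close> is commutative.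
\<close>

definition given_by_ensemble :: "('a symalg \<Rightarrow> complex) \<Rightarrow> ('a list \<Rightarrow> complex) \<Rightarrow> bool" where
  "given_by_ensemble \<alpha> F \<longleftrightarrow> Vector_Spaces.linear scale (*) \<alpha> \<and>
     (\<forall>xs. xs \<noteq> [] \<longrightarrow> \<alpha> (prod_list (map field_op xs)) = F xs)"

text \<open>
  Labels may be repeated, so the partitions are partitions of the set of positions
  \<open>{..<length xs}\<close>; \<open>nths xs I\<close> lists the labels at the positions in \<open>I\<close>.
\<close>

definition complete_from_connected :: "('a list \<Rightarrow> complex) \<Rightarrow> ('a list \<Rightarrow> complex) \<Rightarrow> bool" where
  "complete_from_connected G Gc \<longleftrightarrow>
     (\<forall>xs. xs \<noteq> [] \<longrightarrow>
        G xs = (\<Sum>k = 1..length xs. \<Sum>P | partition_on {..<length xs} P \<and> card P = k.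
                  \<Prod>I\<in>P. Gc (nths xs I)))"

end

theory Submission
  imports Defs
begin

text \<open>
  On a monomial the coproduct splits the set of factors into two complementary subsets in all
  possible ways, so \<open>\<sigma>\<^sup>k\<close> (convolution power) sums over the ordered decompositions of the set of
  factors into \<open>k\<close> blocks.  As \<open>\<sigma>(1) = 0\<close>, empty blocks do not contribute, and every unordered
  partition into \<open>k\<close> blocks is met \<open>k!\<close> times.  Hence \<open>\<sigma>\<^sup>k / k!\<close> is the sum over the partitions into
  \<open>k\<close> blocks, which vanishes once \<open>k\<close> exceeds the number of factors.
\<close>

section \<open>Sums over set partitions\<close>

text \<open>For weights depending only on the size of a block these are the partial Bell
  polynomials; here the weight of a block may depend on its elements.\<close>

definition partition_sum :: "('i set \<Rightarrow> 'c) \<Rightarrow> 'i set \<Rightarrow> nat \<Rightarrow> 'c::comm_semiring_1" where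
  "partition_sum w A k = (\<Sum>P | partition_on A P \<and> card P = k. \<Prod>I\<in>P. w I)"

lemma finite_partition_on_card: "finite A \<Longrightarrow> finite {P. partition_on A P \<and> card P = k}"
  using finitely_many_partition_on[of A] by (rule rev_finite_subset) auto

text \<open>Blocks are non-empty and disjoint, so their sizes, each at least 1, add up to
  \<open>card A\<close>.\<close>

lemma card_partition_on_le:
  assumes "finite A" "partition_on A P"
  shows "card P \<le> card A"
proof -
  have fin: "finite I" if "I \<in> P" for I
    using assms that by (metis Union_upper finite_subset partition_onD1)
  have "card P = (\<Sum>I\<in>P. 1)" by simp
  also have "\<dots> \<le> (\<Sum>I\<in>P. card I)"
  proof (rule sum_mono)
    fix I assume "I \<in> P"
    then show "1 \<le> card I"
      using fin[of I] partition_onD3[OF assms(2)] by (metis One_nat_def Suc_leI card_gt_0_iff)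
  qed
  also have "\<dots> = card A" using product_partition[OF assms(2) fin] by simp
  finally show ?thesis .
qed

text \<open>This makes the exponential series terminate on every monomial.\<close>

lemma partition_sum_eq_0:
  assumes "finite A" "card A < k"
  shows "partition_sum w A k = 0"
proof -
  have "{P. partition_on A P \<and> card P = k} = {}"
    using card_partition_on_le[OF assms(1)] assms(2) by fastforce
  then show ?thesis unfolding partition_sum_def by (simp only: sum.empty)
qed

lemma partition_sum_zero:
  assumes "finite A"
  shows "partition_sum w A 0 = (if A = {} then 1 else 0)"
proof -
  \<comment> \<open>\<open>card P = 0\<close> alone would admit infinite \<open>P\<close>;
    finiteness of \<open>A\<close> excludes these and leaves the empty family, which partitions only
    the empty set.\<close>
  have "{P. partition_on A P \<and> card P = 0} = (if A = {} then {{}} else {})"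
    using finite_elements[OF assms] by (auto simp: partition_on_def)
  then show ?thesis by (simp add: partition_sum_def)
qed

text \<open>Double counting of the pairs of a partition into \<open>Suc k\<close> blocks and one of its blocks.\<close>

lemma partition_sum_Suc:
  assumes "finite A"
  shows "of_nat (Suc k) * partition_sum w A (Suc k) =
    (\<Sum>B\<in>Pow A - {{}}. w B * partition_sum w (A - B) k)"
proof -
  let ?R = "\<lambda>A k. {P. partition_on A P \<and> card P = k}"
  have fin: "finite P" if "partition_on A P" for P
    using finite_elements[OF assms that] .
  \<comment> \<open>The blocks of \<open>Q\<close> lie in \<open>A - B\<close>, so inserting the
    non-empty \<open>B\<close> into \<open>Q\<close> adds a new block and is undone by removing
    it.\<close>
  have notin: "B \<notin> Q" and disj: "disjnt B (\<Union>Q)" if "partition_on (A - B) Q" "B \<noteq> {}" for B Q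
    using that by (auto simp: partition_on_def disjnt_iff)
  \<comment> \<open>The factor \<open>Suc k\<close> is the number of blocks \<open>B\<close> of each
    \<open>P\<close>.\<close>
  have "of_nat (Suc k) * partition_sum w A (Suc k) = (\<Sum>P\<in>?R A (Suc k). \<Sum>B\<in>P. \<Prod>I\<in>P. w I)"
    by (simp add: partition_sum_def sum_distrib_left)
  also have "\<dots> = (\<Sum>(P, B)\<in>Sigma (?R A (Suc k)) (\<lambda>P. P). \<Prod>I\<in>P. w I)"
    by (rule sum.Sigma) (use finite_partition_on_card[OF assms] fin in auto)
  also have "\<dots> = (\<Sum>(B, Q)\<in>Sigma (Pow A - {{}}) (\<lambda>B. ?R (A - B) k). w B * (\<Prod>I\<in>Q. w I))"
  proof (rule sum.reindex_bij_witness[where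
        i = "\<lambda>(B, Q). (insert B Q, B)" and j = "\<lambda>(P, B). (B, P - {B})"], goal_cases)
    case (1 a)
    then show ?case by auto
  next
    case (2 a)
    then obtain P B where a: "a = (P, B)" and P: "partition_on A P" "card P = Suc k" and B: "B \<in> P"
      by auto
    have "disjnt B (\<Union>(P - {B}))"
      using partition_onD2[OF P(1)] B by (auto simp: disjnt_def pairwise_def)
    moreover have "partition_on A (insert B (P - {B}))"
      using P(1) B by (simp add: insert_absorb)
    ultimately have "partition_on (A - B) (P - {B}) \<and> B \<subseteq> A \<and> B \<noteq> {}"
      using partition_on_insert by blast
    then show ?case using P B by (simp add: a)
  next
    case (3 b)
    then obtain B Q where "b = (B, Q)" "partition_on (A - B) Q" "B \<noteq> {}" by auto
    then show ?case using notin[of B Q] by auto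
  next
    case (4 b)
    then obtain B Q where b: "b = (B, Q)" "B \<subseteq> A" and Q: "partition_on (A - B) Q" "B \<noteq> {}" "card Q = k"
      by auto
    have "finite Q" using finite_elements[OF _ Q(1)] assms by simp
    then show ?case
      using b Q notin[OF Q(1,2)] partition_on_insert[OF disj[OF Q(1,2)], of A] by auto
  next
    case (5 a)
    then obtain P B where a: "a = (P, B)" "partition_on A P" "B \<in> P" by auto
    then show ?case using prod.remove[OF fin, of P B w] by simp
  qed
  also have "\<dots> = (\<Sum>B\<in>Pow A - {{}}. \<Sum>Q\<in>?R (A - B) k. w B * (\<Prod>I\<in>Q. w I))"
    by (rule sum.Sigma[symmetric]) (use assms finite_partition_on_card in auto)
  finally show ?thesis by (simp add: partition_sum_def sum_distrib_left)
qed


section \<open>Convolution powers on monomials\<close>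

text \<open>Labels may repeat, so factors are indexed by positions: equal factors at different
  positions stay distinct when subsets are summed over.\<close>

definition monomial :: "('i \<Rightarrow> 'a) \<Rightarrow> 'i set \<Rightarrow> 'a symalg" where
  "monomial f A = Poly_Mapping.single (image_mset f (mset_set A)) 1"

lemma monomial_empty: "monomial f {} = 1"
  by (simp add: monomial_def flip: single_one zero_multiset_def)

lemma prod_field_op:
  assumes "finite A"
  shows "(\<Prod>i\<in>A. field_op (f i)) = monomial f A"
  using assms
  by (induction A rule: finite_induct)
    (simp_all add: monomial_empty, simp add: monomial_def field_op_def mult_single)

lemma prod_tensor:
  "(\<Prod>i\<in>A. tensor (p i) (q i)) = tensor (\<Prod>i\<in>A. p i) (\<Prod>i\<in>A. q i)"
  by (induction A rule: infinite_finite_induct) (simp_all add: tensor_one tensor_mult)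

text \<open>Multiplicativity yields a product of two-term sums; on expansion, \<open>B\<close>
  collects the positions whose factor goes to the left tensor slot.\<close>

lemma coproduct_monomial:
  assumes "finite A"
  shows "coproduct (monomial f A) = (\<Sum>B\<in>Pow A. tensor (monomial f B) (monomial f (A - B)))"
proof -
  have "coproduct (monomial f A) =
      (\<Prod>i\<in>A. tensor (field_op (f i)) 1 + tensor 1 (field_op (f i)))"
    by (simp add: coproduct_def monomial_def vector_space_scale prod_unfold_prod_mset
        image_mset.compositionality comp_def)
  also have "\<dots> = (\<Sum>B\<in>Pow A. (\<Prod>i\<in>B. tensor (field_op (f i)) 1) *
      (\<Prod>i\<in>A - B. tensor 1 (field_op (f i))))"
    by (rule prod_add[OF assms])
  also have "\<dots> = (\<Sum>B\<in>Pow A. tensor (monomial f B) (monomial f (A - B)))"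
  proof (rule sum.cong[OF refl])
    fix B assume "B \<in> Pow A"
    then have "finite B" "finite (A - B)" using assms finite_subset by auto
    then show "(\<Prod>i\<in>B. tensor (field_op (f i)) 1) * (\<Prod>i\<in>A - B. tensor 1 (field_op (f i))) =
        tensor (monomial f B) (monomial f (A - B))"
      by (simp add: prod_tensor prod_field_op tensor_mult)
  qed
  finally show ?thesis .
qed

lemma linear_convolution:
  assumes "Vector_Spaces.linear scale (*) \<alpha>" "Vector_Spaces.linear scale (*) \<beta>"
  shows "Vector_Spaces.linear scale (*) (\<alpha> \<star> \<beta>)"
  unfolding convolution_def
  using coproduct_unique(1) tensor_map_unique(1)[OF assms]
  by (auto simp: algebra_hom_def intro: Vector_Spaces.linear_compose)

lemma linear_conv_power:
  assumes "Vector_Spaces.linear scale (*) \<alpha>"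
  shows "Vector_Spaces.linear scale (*) (conv_power \<alpha> k)"
  by (induction k) (simp_all add: linear_counit linear_convolution[OF assms])

lemma convolution_monomial:
  assumes "Vector_Spaces.linear scale (*) \<alpha>" "Vector_Spaces.linear scale (*) \<beta>" "finite A"
  shows "(\<alpha> \<star> \<beta>) (monomial f A) = (\<Sum>B\<in>Pow A. \<alpha> (monomial f B) * \<beta> (monomial f (A - B)))"
proof -
  interpret h: Vector_Spaces.linear scale "(*)" "tensor_map \<alpha> \<beta>"
    by (rule tensor_map_unique(1)[OF assms(1,2)])
  show ?thesis
    by (simp add: convolution_def coproduct_monomial[OF assms(3)] h.sum
        tensor_map_unique(2)[OF assms(1,2)])
qed

lemma counit_monomial: "finite A \<Longrightarrow> counit (monomial f A) = (if A = {} then 1 else 0)"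
  by (simp add: counit_def monomial_def lookup_single when_def mset_set_empty_iff)

text \<open>Induction on \<open>k\<close> with \<open>A\<close> arbitrary, since splitting off a
  block \<open>B\<close> leaves the monomial over \<open>A - B\<close>. The factor
  \<open>Suc k\<close> from the recursion for partition sums builds up the factorial.\<close>

lemma conv_power_monomial:
  assumes "Vector_Spaces.linear scale (*) \<sigma>" "\<sigma> 1 = 0" "finite A"
  shows "conv_power \<sigma> k (monomial f A) = fact k * partition_sum (\<lambda>I. \<sigma> (monomial f I)) A k"
  using assms(3)
proof (induction k arbitrary: A)
  case 0
  then show ?case by (simp add: counit_monomial partition_sum_zero)
next
  case (Suc k)
  let ?w = "\<lambda>I. \<sigma> (monomial f I)"
  have "conv_power \<sigma> (Suc k) (monomial f A) =
      (\<Sum>B\<in>Pow A. ?w B * conv_power \<sigma> k (monomial f (A - B)))"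
    using convolution_monomial[OF assms(1) linear_conv_power[OF assms(1)] Suc.prems] by simp
  \<comment> \<open>The term for \<open>B = {}\<close> carries the factor
    \<open>\<sigma> 1 = 0\<close>.\<close>
  also have "\<dots> = (\<Sum>B\<in>Pow A - {{}}. ?w B * conv_power \<sigma> k (monomial f (A - B)))"
    by (rule sum.mono_neutral_right) (use Suc.prems assms(2) in \<open>auto simp: monomial_empty\<close>)
  also have "\<dots> = fact k * (\<Sum>B\<in>Pow A - {{}}. ?w B * partition_sum ?w (A - B) k)"
    using Suc by (simp add: sum_distrib_left mult.left_commute)
  also have "\<dots> = fact k * (of_nat (Suc k) * partition_sum ?w A (Suc k))"
    by (simp only: partition_sum_Suc[OF Suc.prems])
  finally show ?case by (simp add: algebra_simps)
qed

text \<open>The factorials cancel, leaving partition sums that vanish beyond \<open>card A\<close>;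
  \<open>sums\<close> records convergence along with the value.\<close>

lemma conv_exp_monomial_sums:
  assumes "Vector_Spaces.linear scale (*) \<sigma>" "\<sigma> 1 = 0" "finite A"
  shows "(\<lambda>k. (1 / fact k) * conv_power \<sigma> k (monomial f A)) sums
    (\<Sum>k\<le>card A. partition_sum (\<lambda>I. \<sigma> (monomial f I)) A k)"
proof -
  have "partition_sum (\<lambda>I. \<sigma> (monomial f I)) A sums
      (\<Sum>k\<le>card A. partition_sum (\<lambda>I. \<sigma> (monomial f I)) A k)"
    by (rule sums_finite) (simp_all add: partition_sum_eq_0[OF assms(3)])
  then show ?thesis by (simp add: conv_power_monomial[OF assms])
qed


section \<open>Point functions\<close>

text \<open>This passes from sublists, the arguments of point functions, to sets of positions;
  multisets suffice because field operators commute.\<close>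

lemma mset_nths:
  assumes "I \<subseteq> {..<length xs}"
  shows "mset (nths xs I) = image_mset ((!) xs) (mset_set I)"
proof -
  have "zip xs [0..<length xs] = map (\<lambda>i. (xs ! i, i)) [0..<length xs]"
    by (rule nth_equalityI) simp_all
  then have "nths xs I = map ((!) xs) (filter (\<lambda>i. i \<in> I) [0..<length xs])"
    by (simp add: nths_def filter_map comp_def)
  moreover have "I = {i \<in> {..<length xs}. i \<in> I}" using assms by auto
  then have "mset_set I = mset (filter (\<lambda>i. i \<in> I) [0..<length xs])"
    by (simp add: atLeast0LessThan)
  ultimately show ?thesis by simp
qed

text \<open>A non-empty \<open>I\<close> selects a non-empty sublist; on the unit the ensemble
  prescribes no value.\<close>

lemma ensemble_nths:
  assumes "given_by_ensemble \<alpha> F" "I \<subseteq> {..<length xs}" "I \<noteq> {}"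
  shows "\<alpha> (monomial ((!) xs) I) = F (nths xs I)"
proof -
  have "nths xs I \<noteq> []" using assms(2,3) by (auto simp flip: set_empty simp: set_nths)
  then have "\<alpha> (prod_list (map field_op (nths xs I))) = F (nths xs I)"
    using assms(1) by (simp add: given_by_ensemble_def)
  then show ?thesis by (simp add: prod_list_field_op monomial_def mset_nths[OF assms(2)])
qed

lemma complete_eq_partition_sums:
  assumes "given_by_ensemble \<rho> G" "given_by_ensemble \<sigma> Gc" "complete_from_connected G Gc"
    and "xs \<noteq> []"
  shows "\<rho> (monomial ((!) xs) {..<length xs}) =
    (\<Sum>k\<le>length xs. partition_sum (\<lambda>I. \<sigma> (monomial ((!) xs) I)) {..<length xs} k)"
proof -
  let ?A = "{..<length xs}" and ?w = "\<lambda>I. \<sigma> (monomial ((!) xs) I)"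
  have "\<rho> (monomial ((!) xs) ?A) = G xs"
    using ensemble_nths[OF assms(1), of ?A xs] assms(4) by (simp add: lessThan_empty_iff)
  also have "\<dots> = (\<Sum>k = 1..length xs. partition_sum (\<lambda>I. Gc (nths xs I)) ?A k)"
    using assms(3,4) by (simp add: complete_from_connected_def partition_sum_def)
  also have "\<dots> = (\<Sum>k = 1..length xs. partition_sum ?w ?A k)"
    unfolding partition_sum_def
  proof (intro sum.cong prod.cong refl)
    fix k P I assume "P \<in> {P. partition_on ?A P \<and> card P = k}" "I \<in> P"
    then have "I \<subseteq> ?A" "I \<noteq> {}" by (auto simp: partition_on_def)
    then show "Gc (nths xs I) = ?w I" by (simp add: ensemble_nths[OF assms(2)])
  qed
  \<comment> \<open>The added term \<open>k = 0\<close> vanishes: a non-empty set has no partition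
    into zero blocks.\<close>
  also have "\<dots> = (\<Sum>k\<le>length xs. partition_sum ?w ?A k)"
    by (rule sum.mono_neutral_left)
      (use assms(4) in \<open>auto simp: partition_sum_zero lessThan_empty_iff not_less_eq_eq\<close>)
  finally show ?thesis .
qed

theorem proposition3:
  fixes \<rho> \<sigma> :: "'a symalg \<Rightarrow> complex" and G Gc :: "'a list \<Rightarrow> complex"
  assumes "given_by_ensemble \<rho> G" and "\<rho> 1 = 1"
    and "given_by_ensemble \<sigma> Gc" and "\<sigma> 1 = 0" and "\<And>x. \<sigma> (field_op x) = 0"
    and "complete_from_connected G Gc"
  shows "(\<forall>s. summable (\<lambda>k. (1 / fact k) * conv_power \<sigma> k s)) \<and> \<rho> = conv_exp \<sigma>"
proof -
  have lin\<rho>: "Vector_Spaces.linear scale (*) \<rho>" and lin\<sigma>: "Vector_Spaces.linear scale (*) \<sigma>"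
    using assms(1,3) by (simp_all add: given_by_ensemble_def)
  have expand: "h s = (\<Sum>M\<in>Poly_Mapping.keys s. Poly_Mapping.lookup s M * h (Poly_Mapping.single M 1))"
    if "Vector_Spaces.linear scale (*) h" for h :: "'a symalg \<Rightarrow> complex" and s
    using fun_cong[OF linear_eq_lin_ext[OF that], of s] by (simp only: lin_ext_def)
  have basis: "(\<lambda>k. (1 / fact k) * conv_power \<sigma> k (Poly_Mapping.single M 1)) sums
      \<rho> (Poly_Mapping.single M 1)" for M
  proof -
    obtain xs where M: "M = mset xs" by (metis ex_mset)
    let ?A = "{..<length xs}"
    have single: "Poly_Mapping.single M 1 = monomial ((!) xs) ?A"
      by (simp add: M monomial_def flip: mset_nths)
    have "(\<Sum>k\<le>card ?A. partition_sum (\<lambda>I. \<sigma> (monomial ((!) xs) I)) ?A k) =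
        \<rho> (monomial ((!) xs) ?A)"
    \<comment> \<open>The relation between \<open>G\<close> and \<open>Gc\<close> covers only
      non-empty lists. On the unit, \<open>\<rho> 1 = 1\<close> matches the empty product over the
      empty partition.\<close>
    proof (cases "xs = []")
      case True
      then show ?thesis using assms(2) by (simp add: partition_sum_zero monomial_empty)
    next
      case False
      then show ?thesis using complete_eq_partition_sums[OF assms(1,3,6)] by simp
    qed
    then show ?thesis
      unfolding single using conv_exp_monomial_sums[OF lin\<sigma> assms(4), of ?A "(!) xs"] by simp
  qed
  \<comment> \<open>Only finitely many monomials occur in \<open>s\<close>, so by linearity of
    \<open>\<rho>\<close> and of each power the series at \<open>s\<close> is a finite combination
    of convergent ones.\<close>
  have sums: "(\<lambda>k. (1 / fact k) * conv_power \<sigma> k s) sums \<rho> s" for s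
  proof -
    have "(\<lambda>k. \<Sum>M\<in>Poly_Mapping.keys s. Poly_Mapping.lookup s M *
        ((1 / fact k) * conv_power \<sigma> k (Poly_Mapping.single M 1))) sums \<rho> s"
      by (subst expand[OF lin\<rho>]) (intro sums_sum sums_mult basis)
    moreover have "(1 / fact k) * conv_power \<sigma> k s = (\<Sum>M\<in>Poly_Mapping.keys s.
        Poly_Mapping.lookup s M * ((1 / fact k) * conv_power \<sigma> k (Poly_Mapping.single M 1)))" for k
      by (subst expand[OF linear_conv_power[OF lin\<sigma>]])
        (simp only: sum_distrib_left mult.left_commute)
    ultimately show ?thesis by simp
  qed
  show ?thesis
    using sums sums_summable sums_unique by (fastforce simp: fun_eq_iff conv_exp_def)
qed

end
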